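(* For every $n\ge 1$, the coefficient of $x^1$ in $P_{n+1,\underline{1}32}(x)=\sum_{\sigma\in S_{n+1}}x^{pmp_{\underline{1}32}(\sigma)}$ equals $\sum_{\sigma\in S_n(132)} inv(\sigma)$.
   Context: For $\sigma=\sigma_1\cdots\sigma_N\in S_N$, $\sigma$ has a $\underline{1}32$-match at position $\ell$ if there exist $j,m$ with $\ell<j<m$ and $\sigma_\ell<\sigma_m<\sigma_j$; $pmp_{\underline{1}32}(\sigma)$ is the number of such positions $\ell$. $S_n(132)$ denotes the set of permutations in $S_n$ avoiding the classical pattern $132$ (no $a<b<c$ with $\sigma_a<\sigma_c<\sigma_b$), and $inv(\sigma)$ is the number of inversions of $\sigma$, i.e. pairs $a<b$ with $\sigma_a>\sigma_b$. *)

theory Defs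
  imports
    "HOL-Combinatorics.Permutations"
    "HOL-Computational_Algebra.Polynomial"
begin

definition S :: "nat \<Rightarrow> (nat \<Rightarrow> nat) set" where
  "S n = {\<sigma>. \<sigma> permutes {1..n}}"

definition matches_132_at :: "nat \<Rightarrow> (nat \<Rightarrow> nat) \<Rightarrow> nat \<Rightarrow> bool" where
  "matches_132_at n \<sigma> l \<longleftrightarrow>
     l \<in> {1..n} \<and> (\<exists>j\<in>{1..n}. \<exists>m\<in>{1..n}. l < j \<and> j < m \<and> \<sigma> l < \<sigma> m \<and> \<sigma> m < \<sigma> j)"

definition pmp_132 :: "nat \<Rightarrow> (nat \<Rightarrow> nat) \<Rightarrow> nat" where
  "pmp_132 n \<sigma> = card {l. matches_132_at n \<sigma> l}"

definition P_132 :: "nat \<Rightarrow> nat poly" where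
  "P_132 n = (\<Sum>\<sigma>\<in>S n. monom 1 (pmp_132 n \<sigma>))"

definition avoids_132 :: "nat \<Rightarrow> (nat \<Rightarrow> nat) \<Rightarrow> bool" where
  "avoids_132 n \<sigma> \<longleftrightarrow>
     \<not> (\<exists>a\<in>{1..n}. \<exists>b\<in>{1..n}. \<exists>c\<in>{1..n}.
          a < b \<and> b < c \<and> \<sigma> a < \<sigma> c \<and> \<sigma> c < \<sigma> b)"

definition S_132 :: "nat \<Rightarrow> (nat \<Rightarrow> nat) set" where
  "S_132 n = {\<sigma> \<in> S n. avoids_132 n \<sigma>}"

definition inv_count :: "nat \<Rightarrow> (nat \<Rightarrow> nat) \<Rightarrow> nat" where
  "inv_count n \<sigma> =
     card {(a, b). a \<in> {1..n} \<and> b \<in> {1..n} \<and> a < b \<and> \<sigma> a > \<sigma> b}"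

end

theory Submission
  imports Defs
begin

text \<open>
  If the only position of \<open>\<sigma>\<close> with a match is \<open>p\<close>, then deleting that entry leaves a 132-avoiding
  permutation \<open>\<tau>\<close> of one letter less. Conversely, inserting an entry with value \<open>v\<close> at position \<open>p\<close> into
  a 132-avoiding \<open>\<tau>\<close> creates a match at \<open>p\<close> exactly if some inversion of \<open>\<tau>\<close> lies to the upper right of
  the new entry. In this case no entry lies to its lower left, as that entry would form a 132 with
  the inversion; hence no other position acquires a match. Moreover, avoidance forces \<open>p\<close> and the
  position of \<open>v\<close> in \<open>\<tau>\<close> to form an inversion themselves, so the admissible insertions into \<open>\<tau>\<close>
  correspond to the inversions \<open>(a, b)\<close> of \<open>\<tau>\<close> via \<open>p = a\<close> and \<open>v = \<tau> b\<close>.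
\<close>

section \<open>Insertion and deletion of an entry\<close>

definition shift_up :: "nat \<Rightarrow> nat \<Rightarrow> nat" where
  "shift_up k i = (if i < k then i else Suc i)"

text \<open>Left inverse of the order embedding \<open>shift_up k\<close>, whose range omits only
  \<open>k\<close>; the value at \<open>k\<close> itself is a default.\<close>

definition shift_down :: "nat \<Rightarrow> nat \<Rightarrow> nat" where
  "shift_down k i = (if i \<le> k then i else i - 1)"

definition insert_entry :: "nat \<Rightarrow> nat \<Rightarrow> (nat \<Rightarrow> nat) \<Rightarrow> nat \<Rightarrow> nat" where
  "insert_entry p v \<tau> i = (if i = p then v else shift_up v (\<tau> (shift_down p i)))"

definition delete_entry :: "nat \<Rightarrow> (nat \<Rightarrow> nat) \<Rightarrow> nat \<Rightarrow> nat" where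
  "delete_entry p \<sigma> i = shift_down (\<sigma> p) (\<sigma> (shift_up p i))"

text \<open>The set counted by \<open>inv_count\<close>, kept as a set because the final bijection
  takes single inversions as arguments.\<close>

definition inversions :: "nat \<Rightarrow> (nat \<Rightarrow> nat) \<Rightarrow> (nat \<times> nat) set" where
  "inversions n \<sigma> = {(a, b). a \<in> {1..n} \<and> b \<in> {1..n} \<and> a < b \<and> \<sigma> a > \<sigma> b}"

lemma shift_down_shift_up [simp]: "shift_down k (shift_up k i) = i"
  by (auto simp: shift_up_def shift_down_def)

lemma shift_up_shift_down: "i \<noteq> k \<Longrightarrow> shift_up k (shift_down k i) = i"
  by (auto simp: shift_up_def shift_down_def)

lemma shift_up_neq [simp]: "shift_up k i \<noteq> k"
  by (auto simp: shift_up_def)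

lemma shift_up_less_iff [simp]: "shift_up k i < shift_up k j \<longleftrightarrow> i < j"
  by (auto simp: shift_up_def)

lemma shift_up_eq_iff [simp]: "shift_up k i = shift_up k j \<longleftrightarrow> i = j"
  by (metis shift_down_shift_up)

lemma shift_up_less_self_iff [simp]: "shift_up k i < k \<longleftrightarrow> i < k"
  by (auto simp: shift_up_def)

lemma less_shift_up_self_iff [simp]: "k < shift_up k i \<longleftrightarrow> k \<le> i"
  by (auto simp: shift_up_def)

text \<open>The bounds on \<open>k\<close> keep 0 below \<open>k\<close> and every
  \<open>i > n\<close> at or above it, so indices outside the range stay outside.\<close>

lemma shift_up_mem_iff:
  "k \<in> {1..Suc n} \<Longrightarrow> shift_up k i \<in> {1..Suc n} \<longleftrightarrow> i \<in> {1..n}"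
  by (auto simp: shift_up_def)

lemma ex_shift_up: "i \<noteq> k \<Longrightarrow> \<exists>j. i = shift_up k j"
  by (metis shift_up_shift_down)

lemma insert_entry_self [simp]: "insert_entry p v \<tau> p = v"
  by (simp add: insert_entry_def)

lemma insert_entry_shift_up [simp]: "insert_entry p v \<tau> (shift_up p i) = shift_up v (\<tau> i)"
  by (simp add: insert_entry_def)

lemma delete_entry_insert_entry: "delete_entry p (insert_entry p v \<tau>) = \<tau>"
  by (simp add: fun_eq_iff delete_entry_def)

lemma insert_entry_delete_entry:
  assumes "inj \<sigma>"
  shows "insert_entry p (\<sigma> p) (delete_entry p \<sigma>) = \<sigma>"
proof
  fix i
  show "insert_entry p (\<sigma> p) (delete_entry p \<sigma>) i = \<sigma> i"
  proof (cases "i = p")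
    case False
    then have "\<sigma> i \<noteq> \<sigma> p"
      using assms by (simp add: inj_eq)
    with False show ?thesis
      by (simp add: insert_entry_def delete_entry_def shift_up_shift_down)
  qed simp
qed

section \<open>Permutations are preserved by insertion and deletion\<close>

lemma permutes_if_bij: "bij f \<Longrightarrow> (\<And>i. i \<notin> A \<Longrightarrow> f i = i) \<Longrightarrow> f permutes A"
  by (simp add: permutes_def bij_iff)

lemma insert_entry_mem_S:
  assumes "\<tau> \<in> S n" and p: "p \<in> {1..Suc n}" and v: "v \<in> {1..Suc n}"
  shows "insert_entry p v \<tau> \<in> S (Suc n)"
proof -
  have \<tau>: "\<tau> permutes {1..n}"
    using assms by (simp add: S_def)
  have "insert_entry p v \<tau> permutes {1..Suc n}"
  proof (rule permutes_if_bij)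
    show "bij (insert_entry p v \<tau>)"
    proof (rule o_bij)
      \<comment> \<open>Inverting a permutation swaps positions with values, so the inverse is again
        an insertion, with \<open>p\<close> and \<open>v\<close> exchanged.\<close>
      show "insert_entry v p (inv \<tau>) \<circ> insert_entry p v \<tau> = id"
        using permutes_inverses[OF \<tau>]
        by (auto simp: fun_eq_iff) (metis ex_shift_up insert_entry_self insert_entry_shift_up)
      show "insert_entry p v \<tau> \<circ> insert_entry v p (inv \<tau>) = id"
        using permutes_inverses[OF \<tau>]
        by (auto simp: fun_eq_iff) (metis ex_shift_up insert_entry_self insert_entry_shift_up)
    qed
    fix i assume "i \<notin> {1..Suc n}"
    moreover from this obtain j where j: "i = shift_up p j"
      using p by (metis ex_shift_up)
    ultimately have "\<tau> j = j"
      using p \<tau> by (metis permutes_not_in shift_up_mem_iff)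
    then have "insert_entry p v \<tau> i = shift_up v j"
      using j by simp
    \<comment> \<open>Either \<open>j = 0\<close> lies below both \<open>p\<close> and
      \<open>v\<close>, or \<open>j > n\<close> lies at or above both; hence the two shifts agree on
      \<open>j\<close>.\<close>
    with j \<open>i \<notin> {1..Suc n}\<close> show "insert_entry p v \<tau> i = i"
      using p v by (auto simp: shift_up_def split: if_splits)
  qed
  then show ?thesis
    by (simp add: S_def)
qed

lemma delete_entry_mem_S:
  assumes "\<sigma> \<in> S (Suc n)" and p: "p \<in> {1..Suc n}"
  shows "delete_entry p \<sigma> \<in> S n"
proof -
  have \<sigma>: "\<sigma> permutes {1..Suc n}"
    using assms by (simp add: S_def)
  have \<sigma>p: "\<sigma> p \<in> {1..Suc n}"
    using permutes_in_image[OF \<sigma>] p by simp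
  have inv_\<sigma>: "inv \<sigma> (\<sigma> i) = i" "\<sigma> (inv \<sigma> i) = i" for i
    using permutes_inverses[OF \<sigma>] by auto
  have ne: "\<sigma> (shift_up p i) \<noteq> \<sigma> p" "inv \<sigma> (shift_up (\<sigma> p) i) \<noteq> p" for i
    by (metis inv_\<sigma> shift_up_neq)+
  have "delete_entry p \<sigma> permutes {1..n}"
  proof (rule permutes_if_bij)
    show "bij (delete_entry p \<sigma>)"
    proof (rule o_bij)
      show "delete_entry (\<sigma> p) (inv \<sigma>) \<circ> delete_entry p \<sigma> = id"
        using ne inv_\<sigma> by (simp add: fun_eq_iff delete_entry_def shift_up_shift_down)
      show "delete_entry p \<sigma> \<circ> delete_entry (\<sigma> p) (inv \<sigma>) = id"
        using ne inv_\<sigma> by (simp add: fun_eq_iff delete_entry_def shift_up_shift_down)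
    qed
    fix i assume i: "i \<notin> {1..n}"
    then have "\<sigma> (shift_up p i) = shift_up p i"
      using \<sigma> p by (metis permutes_not_in shift_up_mem_iff)
    with i show "delete_entry p \<sigma> i = i"
      using p \<sigma>p by (auto simp: delete_entry_def shift_up_def shift_down_def)
  qed
  then show ?thesis
    by (simp add: S_def)
qed

section \<open>Matches after an insertion\<close>

lemma avoids_132D:
  assumes "avoids_132 n \<tau>" "1 \<le> a" "a < b" "b < c" "c \<le> n" "\<tau> a < \<tau> c"
  shows "\<tau> b \<le> \<tau> c"
proof (rule ccontr)
  assume "\<not> \<tau> b \<le> \<tau> c"
  moreover have "a \<in> {1..n}" "b \<in> {1..n}" "c \<in> {1..n}"
    using assms by auto
  ultimately show False
    using assms unfolding avoids_132_def by (metis not_le)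
qed

lemma matches_132_atI:
  assumes "l \<in> {1..n}" "j \<in> {1..n}" "m \<in> {1..n}" "l < j" "j < m" "\<sigma> l < \<sigma> m" "\<sigma> m < \<sigma> j"
  shows "matches_132_at n \<sigma> l"
  using assms unfolding matches_132_at_def by blast

lemma matches_insert_entry_iff:
  assumes \<tau>: "\<tau> \<in> S n" and p: "p \<in> {1..Suc n}" and v: "v \<in> {1..Suc n}"
  shows "{l. matches_132_at (Suc n) (insert_entry p v \<tau>) l} = {p} \<longleftrightarrow>
    avoids_132 n \<tau> \<and> (\<exists>b. (p, b) \<in> inversions n \<tau> \<and> v = \<tau> b)"
    (is "?L \<longleftrightarrow> ?R")
proof
  let ?\<sigma> = "insert_entry p v \<tau>"
  assume L: ?L
  \<comment> \<open>The shifts preserve order, so a 132 in \<open>\<tau>\<close> would survive and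
    give a match at a position other than \<open>p\<close>.\<close>
  have avoids: "avoids_132 n \<tau>"
    unfolding avoids_132_def
  proof (safe, goal_cases)
    case (1 a b c)
    then have "matches_132_at (Suc n) ?\<sigma> (shift_up p a)"
      using p by (intro matches_132_atI[of _ _ "shift_up p b" "shift_up p c"])
        (simp_all only: shift_up_mem_iff insert_entry_shift_up shift_up_less_iff)
    with L have "shift_up p a = p"
      by blast
    then show False
      by simp
  qed
  from L have "matches_132_at (Suc n) ?\<sigma> p"
    by blast
  then obtain j m where jm: "j \<in> {1..Suc n}" "m \<in> {1..Suc n}"
      "p < j" "j < m" "v < ?\<sigma> m" "?\<sigma> m < ?\<sigma> j"
    by (auto simp: matches_132_at_def)
  obtain b c where bc: "j = shift_up p b" "m = shift_up p c"
    using jm by (metis ex_shift_up less_irrefl less_trans)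
  have b: "b \<in> {1..n}" and c: "c \<in> {1..n}"
    using jm bc p by (metis shift_up_mem_iff)+
  have ineqs: "p \<le> b" "b < c" "v \<le> \<tau> c" "\<tau> c < \<tau> b"
    using jm bc by auto
  have \<tau>_permutes: "\<tau> permutes {1..n}"
    using \<tau> by (simp add: S_def)
  have "\<tau> c \<in> {1..n}"
    using permutes_in_image[OF \<tau>_permutes] c by simp
  \<comment> \<open>The match puts \<open>v\<close> at or below an old value, which excludes
    \<open>v = n + 1\<close>.\<close>
  then have "v \<in> {1..n}"
    using ineqs v by auto
  then obtain q where q: "q \<in> {1..n}" "v = \<tau> q"
    using permutes_image[OF \<tau>_permutes] by blast
  \<comment> \<open>Otherwise \<open>p\<close>, \<open>b\<close>, \<open>c\<close> would form a 132
    in \<open>\<tau>\<close>, or \<open>p = b\<close> would contradict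
    \<open>\<tau> c < \<tau> b\<close>. The next claim follows in the same way with \<open>q\<close>
    in place of \<open>p\<close>.\<close>
  have "\<tau> c < \<tau> p"
  proof (rule ccontr)
    assume "\<not> \<tau> c < \<tau> p"
    moreover have "\<tau> p \<noteq> \<tau> c"
      using ineqs permutes_inj[OF \<tau>_permutes] by (auto simp: inj_eq)
    ultimately show False
      using avoids_132D[OF avoids, of p b c] p b c ineqs by (cases "p = b") auto
  qed
  moreover have "p < q"
  proof (rule ccontr)
    assume "\<not> p < q"
    then have "q \<le> b" "q \<noteq> c"
      using ineqs by auto
    moreover have "\<tau> q \<noteq> \<tau> c"
      using \<open>q \<noteq> c\<close> permutes_inj[OF \<tau>_permutes] by (auto simp: inj_eq)
    ultimately show False
      using avoids_132D[OF avoids, of q b c] q c ineqs by (cases "q = b") auto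
  qed
  ultimately have "(p, q) \<in> inversions n \<tau>"
    using p q ineqs b by (auto simp: inversions_def)
  with avoids q show ?R
    by blast
next
  let ?\<sigma> = "insert_entry p v \<tau>"
  assume ?R
  then obtain b where avoids: "avoids_132 n \<tau>" and pb: "p < b" "b \<le> n" "\<tau> b < \<tau> p"
    and v_eq: "v = \<tau> b"
    by (auto simp: inversions_def)
  \<comment> \<open>The old entries at \<open>p\<close> and \<open>b\<close> both move one step
    right and one step up, as their values are at least \<open>v = \<tau> b\<close>. They form an
    inversion above and to the right of the new entry.\<close>
  have "matches_132_at (Suc n) ?\<sigma> p"
  proof (rule matches_132_atI)
    show "shift_up p p \<in> {1..Suc n}" "shift_up p b \<in> {1..Suc n}"
      using p pb by (auto simp: shift_up_def)
  qed (use p pb v_eq in auto)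
  moreover have "l = p" if "matches_132_at (Suc n) ?\<sigma> l" for l
  proof (rule ccontr)
    assume "l \<noteq> p"
    from that obtain j m where l: "l \<in> {1..Suc n}" and jm: "j \<in> {1..Suc n}" "m \<in> {1..Suc n}"
      "l < j" "j < m" "?\<sigma> l < ?\<sigma> m" "?\<sigma> m < ?\<sigma> j"
      by (auto simp: matches_132_at_def)
    obtain a where a: "l = shift_up p a"
      using \<open>l \<noteq> p\<close> by (metis ex_shift_up)
    have a_mem: "a \<in> {1..n}"
      using l a p by (metis shift_up_mem_iff)
    \<comment> \<open>Such an entry would form a 132 with the inversion at \<open>p\<close> and
      \<open>b\<close>.\<close>
    have lower_left: "\<not> (a < p \<and> \<tau> a < v)"
      using avoids_132D[OF avoids, of a p b] a_mem pb v_eq by auto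
    \<comment> \<open>If the new entry takes part in the match as its second or third letter, then
      \<open>l\<close> lies to its lower left; if not, the match is a 132 of
      \<open>\<tau>\<close>.\<close>
    consider "j = p" | "m = p" | j' m' where "j = shift_up p j'" "m = shift_up p m'"
      by (metis ex_shift_up)
    then show False
    proof cases
      case 1
      then have "l < p" "?\<sigma> l < v"
        using jm by auto
      with lower_left a show False
        by simp
    next
      case 2
      then have "l < p" "?\<sigma> l < v"
        using jm by auto
      with lower_left a show False
        by simp
    next
      case 3
      then have "m' \<in> {1..n}"
        using jm p by (metis shift_up_mem_iff)
      with 3 show False
        using avoids_132D[OF avoids, of a j' m'] jm a a_mem by auto
    qed
  qed
  ultimately show ?L
    by blast
qed

section \<open>The bijection and the count\<close>

lemma bij_betw_inversions_single_match:
  "bij_betw (\<lambda>(\<tau>, a, b). insert_entry a (\<tau> b) \<tau>)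
     (SIGMA \<tau>:S_132 n. inversions n \<tau>) {\<sigma> \<in> S (Suc n). pmp_132 (Suc n) \<sigma> = 1}"
  (is "bij_betw ?f ?A ?B")
proof -
  have single: "insert_entry a (\<tau> b) \<tau> \<in> S (Suc n)"
      "{l. matches_132_at (Suc n) (insert_entry a (\<tau> b) \<tau>) l} = {a}"
    if "\<tau> \<in> S_132 n" "(a, b) \<in> inversions n \<tau>" for \<tau> a b
  proof -
    have \<tau>: "\<tau> \<in> S n" "avoids_132 n \<tau>"
      using that by (auto simp: S_132_def)
    have "a \<in> {1..Suc n}" "b \<in> {1..n}"
      using that by (auto simp: inversions_def)
    moreover from this have "\<tau> b \<in> {1..n}"
      using \<tau> permutes_in_image[of \<tau> "{1..n}"] by (simp add: S_def)
    then have "\<tau> b \<in> {1..Suc n}"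
      by simp
    ultimately show "insert_entry a (\<tau> b) \<tau> \<in> S (Suc n)"
        "{l. matches_132_at (Suc n) (insert_entry a (\<tau> b) \<tau>) l} = {a}"
      using \<tau> that insert_entry_mem_S matches_insert_entry_iff by blast+
  qed
  have "inj_on ?f ?A"
  proof (rule inj_onI, clarsimp)
    fix \<tau> a b \<tau>' a' b'
    assume \<tau>: "\<tau> \<in> S_132 n" "(a, b) \<in> inversions n \<tau>"
      and \<tau>': "\<tau>' \<in> S_132 n" "(a', b') \<in> inversions n \<tau>'"
      and eq: "insert_entry a (\<tau> b) \<tau> = insert_entry a' (\<tau>' b') \<tau>'"
    \<comment> \<open>The unique matching position recovers \<open>a\<close>; deleting there
      recovers \<open>\<tau>\<close>, and the value there recovers \<open>b\<close>.\<close>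
    have a: "a = a'"
      using single(2)[OF \<tau>] single(2)[OF \<tau>'] eq by simp
    then have "\<tau> = \<tau>'" "\<tau> b = \<tau>' b'"
      using eq by (metis delete_entry_insert_entry, metis insert_entry_self)
    moreover have "inj \<tau>"
      using \<tau> by (auto simp: S_132_def S_def intro: permutes_inj)
    ultimately show "\<tau> = \<tau>' \<and> a = a' \<and> b = b'"
      using a by (simp add: inj_eq)
  qed
  moreover have "?f ` ?A \<subseteq> ?B"
    using single by (auto simp: pmp_132_def)
  moreover have "?B \<subseteq> ?f ` ?A"
  proof
    fix \<sigma> assume "\<sigma> \<in> ?B"
    then have \<sigma>: "\<sigma> \<in> S (Suc n)" and "card {l. matches_132_at (Suc n) \<sigma> l} = 1"
      by (auto simp: pmp_132_def)
    then obtain p where L: "{l. matches_132_at (Suc n) \<sigma> l} = {p}"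
      by (auto simp: card_1_singleton_iff)
    then have p: "p \<in> {1..Suc n}"
      unfolding matches_132_at_def by blast
    define \<tau> where "\<tau> = delete_entry p \<sigma>"
    have "\<tau> \<in> S n"
      unfolding \<tau>_def using \<sigma> p by (rule delete_entry_mem_S)
    have "\<sigma> permutes {1..Suc n}"
      using \<sigma> by (simp add: S_def)
    then have \<sigma>_eq: "insert_entry p (\<sigma> p) \<tau> = \<sigma>" and \<sigma>p: "\<sigma> p \<in> {1..Suc n}"
      using p permutes_in_image[of \<sigma> "{1..Suc n}" p]
      by (auto simp: \<tau>_def insert_entry_delete_entry permutes_inj)
    obtain b where "avoids_132 n \<tau>" "(p, b) \<in> inversions n \<tau>" "\<sigma> p = \<tau> b"
      using matches_insert_entry_iff[OF \<open>\<tau> \<in> S n\<close> p \<sigma>p] \<sigma>_eq L by auto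
    then show "\<sigma> \<in> ?f ` ?A"
      using \<open>\<tau> \<in> S n\<close> \<sigma>_eq by (intro image_eqI[of _ _ "(\<tau>, p, b)"]) (auto simp: S_132_def)
  qed
  ultimately show ?thesis
    unfolding bij_betw_def by blast
qed

theorem theorem6:
  fixes n :: nat
  assumes "n \<ge> 1"
  shows "coeff (P_132 (n + 1)) 1 = (\<Sum>\<sigma>\<in>S_132 n. inv_count n \<sigma>)"
proof -
  have finite_S: "finite (S k)" for k
    by (simp add: S_def finite_permutations)
  have finite_inversions: "finite (inversions n \<tau>)" for \<tau>
    by (rule finite_subset[of _ "{1..n} \<times> {1..n}"]) (auto simp: inversions_def)
  \<comment> \<open>Each monomial contributes 1 exactly if its permutation has a single matching
    position.\<close>
  have "coeff (P_132 (n + 1)) 1 = (\<Sum>\<sigma>\<in>S (Suc n). if pmp_132 (Suc n) \<sigma> = 1 then 1 else 0)"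
    by (simp only: P_132_def coeff_sum coeff_monom Suc_eq_plus1)
  also have "\<dots> = card {\<sigma> \<in> S (Suc n). pmp_132 (Suc n) \<sigma> = 1}"
    using finite_S by (simp add: sum.If_cases Int_def)
  also have "\<dots> = card (SIGMA \<tau>:S_132 n. inversions n \<tau>)"
    using bij_betw_same_card[OF bij_betw_inversions_single_match] by simp
  also have "\<dots> = (\<Sum>\<tau>\<in>S_132 n. card (inversions n \<tau>))"
    using finite_S finite_inversions by (simp add: S_132_def)
  also have "\<dots> = (\<Sum>\<sigma>\<in>S_132 n. inv_count n \<sigma>)"
    by (simp add: inv_count_def inversions_def)
  finally show ?thesis .
qed

end
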